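(* Let $G$ be a finite group and $N$ a solvable normal subgroup of $G$. If $u$ is a torsion element of $\mathrm{V}(\mathbb{Z}G,N)$, then the order of $u$ divides $|N|$.
   Context: $\mathbb{Z}G$ is the integral group ring of $G$. The augmentation map $\varepsilon:\mathbb{Z}G\to\mathbb{Z}$ sends $\sum_{g}a_g g$ to $\sum_g a_g$; $\mathrm{V}(\mathbb{Z}G)$ denotes the group of units of $\mathbb{Z}G$ of augmentation $1$ (normalized units). For a normal subgroup $N$ of $G$, $\omega_N:\mathbb{Z}G\to\mathbb{Z}(G/N)$ is the ring homomorphism induced by the natural projection $G\to G/N$, and $\mathrm{V}(\mathbb{Z}G,N)=\{u\in\mathrm{V}(\mathbb{Z}G):\omega_N(u)=1\}$. *)

theory Defs
  imports "HOL-Algebra.Algebra"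
begin

text \<open>Elements of the integral group ring ZG of a finite group G are represented as
  integer-valued functions on the carrier of G that vanish outside the carrier
  (the coefficient function of sum_g a_g g).\<close>

definition grp_ring_elem :: "('a, 'b) monoid_scheme \<Rightarrow> ('a \<Rightarrow> int) \<Rightarrow> bool" where
  "grp_ring_elem G f \<longleftrightarrow> (\<forall>x. x \<notin> carrier G \<longrightarrow> f x = 0)"

definition grp_ring_one :: "('a, 'b) monoid_scheme \<Rightarrow> ('a \<Rightarrow> int)" where
  "grp_ring_one G = (\<lambda>x. if x = \<one>\<^bsub>G\<^esub> then 1 else 0)"

definition grp_ring_mult :: "('a, 'b) monoid_scheme \<Rightarrow> ('a \<Rightarrow> int) \<Rightarrow> ('a \<Rightarrow> int) \<Rightarrow> ('a \<Rightarrow> int)" where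
  "grp_ring_mult G f g =
     (\<lambda>x. if x \<in> carrier G then (\<Sum>y\<in>carrier G. f y * g (inv\<^bsub>G\<^esub> y \<otimes>\<^bsub>G\<^esub> x)) else 0)"

primrec grp_ring_pow :: "('a, 'b) monoid_scheme \<Rightarrow> ('a \<Rightarrow> int) \<Rightarrow> nat \<Rightarrow> ('a \<Rightarrow> int)" where
  "grp_ring_pow G f 0 = grp_ring_one G"
| "grp_ring_pow G f (Suc n) = grp_ring_mult G (grp_ring_pow G f n) f"

definition augmentation :: "('a, 'b) monoid_scheme \<Rightarrow> ('a \<Rightarrow> int) \<Rightarrow> int" where
  "augmentation G f = (\<Sum>x\<in>carrier G. f x)"

definition grp_ring_unit :: "('a, 'b) monoid_scheme \<Rightarrow> ('a \<Rightarrow> int) \<Rightarrow> bool" where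
  "grp_ring_unit G u \<longleftrightarrow> grp_ring_elem G u \<and>
     (\<exists>v. grp_ring_elem G v \<and> grp_ring_mult G u v = grp_ring_one G \<and> grp_ring_mult G v u = grp_ring_one G)"

definition normalized_units :: "('a, 'b) monoid_scheme \<Rightarrow> ('a \<Rightarrow> int) set" where
  "normalized_units G = {u. grp_ring_unit G u \<and> augmentation G u = 1}"

text \<open>omega_N : ZG -> Z(G/N), induced by the projection G -> G/N; the coefficient
  of a coset C is the sum of the coefficients of its elements.\<close>
definition omega :: "('a, 'b) monoid_scheme \<Rightarrow> 'a set \<Rightarrow> ('a \<Rightarrow> int) \<Rightarrow> ('a set \<Rightarrow> int)" where
  "omega G N f = (\<lambda>C. if C \<in> carrier (G Mod N) then (\<Sum>x\<in>C. f x) else 0)"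

definition rel_normalized_units :: "('a, 'b) monoid_scheme \<Rightarrow> 'a set \<Rightarrow> ('a \<Rightarrow> int) set" where
  "rel_normalized_units G N = {u \<in> normalized_units G. omega G N u = grp_ring_one (G Mod N)}"

definition grp_ring_torsion :: "('a, 'b) monoid_scheme \<Rightarrow> ('a \<Rightarrow> int) \<Rightarrow> bool" where
  "grp_ring_torsion G u \<longleftrightarrow> (\<exists>n>0. grp_ring_pow G u n = grp_ring_one G)"

definition grp_ring_ord :: "('a, 'b) monoid_scheme \<Rightarrow> ('a \<Rightarrow> int) \<Rightarrow> nat" where
  "grp_ring_ord G u = (LEAST n. n > 0 \<and> grp_ring_pow G u n = grp_ring_one G)"

end

theory Submission
  imports Defs "HOL-Library.Function_Algebras"
begin

text \<open>Let \<open>u\<close> act by left multiplication on the lattices \<open>\<int>[G/H]\<close>, realised as the right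
  \<open>H\<close>-invariant functions on \<open>G\<close>. The hypothesis says that \<open>u\<close> acts trivially on \<open>\<int>[G/N]\<close>. As \<open>N\<close>
  is solvable, there is a chain from \<open>N\<close> to the trivial group, each term normal of prime index in the
  preceding one (but not necessarily normal in \<open>G\<close>), so it suffices to show: if \<open>K\<close> is
  normal in \<open>K'\<close> with prime index \<open>p\<close> and a power \<open>v\<close> of \<open>u\<close> acts trivially on \<open>\<int>[G/K']\<close>, then
  \<open>v ^ p\<close> acts trivially on \<open>\<int>[G/K]\<close>.

  A generator of \<open>K'/K\<close> acts on \<open>\<int>[G/K]\<close> by an operator \<open>R\<close> that commutes with \<open>v\<close>. On the
  kernel \<open>M\<close> of the norm \<open>1 + R + \<dots> + R ^ (p - 1)\<close> put \<open>\<tau> = R - 1\<close>. Then \<open>M\<close> is a lattice over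
  \<open>\<int>[\<zeta>]\<close>, where \<open>\<zeta>\<close> is a primitive \<open>p\<close>-th root of unity, and \<open>v - 1\<close> maps \<open>\<int>[G/K]\<close> into
  \<open>M = \<tau> \<int>[G/K]\<close>, so \<open>v \<equiv> 1\<close> modulo \<open>\<tau>\<close> on \<open>M\<close> and \<open>v ^ p \<equiv> 1\<close> modulo \<open>\<tau> ^ 2\<close>. By the
  \<open>\<tau>\<close>-adic form of Minkowski's lemma a torsion operator congruent to \<open>1\<close> modulo \<open>\<tau> ^ 2\<close> is trivial.
  Hence \<open>v ^ p - 1\<close> vanishes on \<open>M\<close>, so it has square zero on \<open>\<int>[G/K]\<close>, and it vanishes
  because \<open>v\<close> is torsion.\<close>

section \<open>Torsion operators congruent to one\<close>

lemma additive_of_nat_mult: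
  fixes T :: "'m::comm_ring_1 \<Rightarrow> 'm"
  assumes "additive T"
  shows "T (of_nat n * f) = of_nat n * T f"
proof -
  interpret additive T by fact
  show ?thesis by (induction n) (simp_all add: zero add distrib_right)
qed

lemma additive_funpow:
  fixes T :: "'m::ab_group_add \<Rightarrow> 'm"
  assumes "additive T"
  shows "additive (T ^^ n)"
proof -
  interpret additive T by fact
  show ?thesis by (induction n) (simp_all add: additive_def add)
qed

text \<open>\<open>M\<close> is just an additive subgroup; the ring structure of the type serves
  here to write integer multiples as \<open>of_nat n * f\<close>.\<close>

locale stable_operator =
  fixes M :: "'m::comm_ring_1 set" and D :: "'m \<Rightarrow> 'm"
  assumes zero_mem: "0 \<in> M"
    and diff_mem: "\<And>f g. f \<in> M \<Longrightarrow> g \<in> M \<Longrightarrow> f - g \<in> M"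
    and additive_D: "additive D"
    and D_mem: "\<And>f. f \<in> M \<Longrightarrow> D f \<in> M"
begin

lemma add_mem: "f \<in> M \<Longrightarrow> g \<in> M \<Longrightarrow> f + g \<in> M"
  using diff_mem[of f "0 - g"] diff_mem[of 0 g] zero_mem by simp

lemma of_nat_mult_mem: "f \<in> M \<Longrightarrow> of_nat n * f \<in> M"
  by (induction n) (simp_all add: zero_mem distrib_right add_mem)

lemma sum_mem: "(\<And>i. i \<in> I \<Longrightarrow> h i \<in> M) \<Longrightarrow> sum h I \<in> M"
  by (induction I rule: infinite_finite_induct) (simp_all add: zero_mem add_mem)

lemma funpow_mem: "f \<in> M \<Longrightarrow> (D ^^ n) f \<in> M"
  by (induction n) (simp_all add: D_mem)

lemmas mem_intros = zero_mem diff_mem D_mem add_mem of_nat_mult_mem sum_mem funpow_mem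

lemmas D_simps = additive.add[OF additive_D] additive.diff[OF additive_D] additive.zero[OF additive_D]
  additive.sum[OF additive_D] additive_of_nat_mult[OF additive_D]

lemmas Dpow_simps = additive.add[OF additive_funpow[OF additive_D]] additive.diff[OF additive_funpow[OF additive_D]]
  additive.zero[OF additive_funpow[OF additive_D]] additive_of_nat_mult[OF additive_funpow[OF additive_D]]

lemma one_plus_power_eq_binomial_sum:
  "((\<lambda>f. f + D f) ^^ n) f = (\<Sum>k\<le>n. of_nat (n choose k) * (D ^^ k) f)"
proof (induction n)
  case (Suc n)
  let ?a = "\<lambda>n k. of_nat (n choose k) :: 'm"
  let ?S = "\<lambda>n. (\<Sum>k\<le>n. ?a n k * (D ^^ k) f)"
  have "?S (Suc n) = f + (\<Sum>k\<le>n. ?a (Suc n) (Suc k) * (D ^^ Suc k) f)"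
    by (subst sum.atMost_Suc_shift) simp
  also have "\<dots> = f + (\<Sum>k\<le>n. ?a n (Suc k) * (D ^^ Suc k) f) + (\<Sum>k\<le>n. ?a n k * (D ^^ Suc k) f)"
    by (simp add: distrib_right sum.distrib add_ac)
  also have "f + (\<Sum>k\<le>n. ?a n (Suc k) * (D ^^ Suc k) f) = (\<Sum>k\<le>Suc n. ?a n k * (D ^^ k) f)"
    by (subst sum.atMost_Suc_shift) simp
  also have "\<dots> = ?S n" by (simp add: binomial_eq_0)
  also have "(\<Sum>k\<le>n. ?a n k * (D ^^ Suc k) f) = D (?S n)"
    by (simp add: D_simps)
  finally show ?case by (simp add: Suc)
qed simp

text \<open>Modulo \<open>D ^ 2\<close> only the linear term survives; applying \<open>1 + D\<close>
  once more turns the remainder \<open>g\<close> into \<open>g + n f + D g\<close>.\<close>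

lemma one_plus_power_linear_term:
  assumes "f \<in> M"
  shows "\<exists>g\<in>M. ((\<lambda>f. f + D f) ^^ n) f = f + of_nat n * D f + D (D g)"
proof (induction n)
  case 0
  show ?case by (rule bexI[of _ 0]) (simp_all add: D_simps zero_mem)
next
  case (Suc n)
  then obtain g where g: "g \<in> M" "((\<lambda>f. f + D f) ^^ n) f = f + of_nat n * D f + D (D g)" by blast
  have "g + of_nat n * f + D g \<in> M" using g assms by (intro mem_intros)
  then show ?case
    by (rule bexI[rotated]) (simp add: g D_simps distrib_right add_ac)
qed

text \<open>The inner binomial coefficients are divisible by \<open>p\<close>, and the terms from
  \<open>k = 2\<close> on contain \<open>D ^ 2\<close>; only the last term \<open>D ^ p\<close>
  lacks the factor \<open>p\<close>.\<close>

lemma one_plus_prime_power: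
  assumes "Factorial_Ring.prime p" "f \<in> M"
  shows "\<exists>g\<in>M. ((\<lambda>f. f + D f) ^^ p) f = f + of_nat p * (D f + D (D g)) + (D ^^ p) f"
proof -
  have p2: "p \<ge> 2" using \<open>Factorial_Ring.prime p\<close> by (rule prime_ge_2_nat)
  define c where "c k = (p choose k) div p" for k
  have c: "p choose k = p * c k" if "0 < k" "k < p" for k
    using dvd_choose_prime[of k p] that assms(1) by (simp add: c_def)
  define g where "g = (\<Sum>k=2..<p. of_nat (c k) * (D ^^ (k - 2)) f)"
  have "D (D ((D ^^ (k - 2)) f)) = (D ^^ k) f" if "k \<ge> 2" for k
  proof -
    have "k = Suc (Suc (k - 2))" using that by simp
    then show ?thesis by (metis comp_apply funpow.simps(2))
  qed
  then have "D (D g) = (\<Sum>k=2..<p. of_nat (c k) * (D ^^ k) f)"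
    unfolding g_def D_simps
    by (intro sum.cong) auto
  then have "of_nat p * D (D g) = (\<Sum>k=2..<p. of_nat (p choose k) * (D ^^ k) f)"
    by (simp add: sum_distrib_left c mult.assoc)
  moreover have "{..p} = insert 0 (insert 1 (insert p {2..<p}))" using p2 by auto
  then have "((\<lambda>f. f + D f) ^^ p) f
      = f + of_nat p * D f + (\<Sum>k=2..<p. of_nat (p choose k) * (D ^^ k) f) + (D ^^ p) f"
    unfolding one_plus_power_eq_binomial_sum using p2 by (simp add: add_ac)
  ultimately have "((\<lambda>f. f + D f) ^^ p) f = f + of_nat p * (D f + D (D g)) + (D ^^ p) f"
    by (simp add: algebra_simps)
  moreover have "g \<in> M" unfolding g_def using assms by (intro mem_intros)
  ultimately show ?thesis by blast
qed

end

text \<open>The model is a lattice over \<open>\<int>[\<zeta>]\<close>, \<open>\<zeta>\<close> a primitive \<open>p\<close>-th root of unity, with \<open>\<tau> = \<zeta> - 1\<close>;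
  the assumptions record what is needed from \<open>p\<close> being associated to \<open>\<tau> ^ (p - 1)\<close>.\<close>

locale tau_adic = \<tau>: stable_operator M \<tau> for M :: "'m::comm_ring_1 set" and \<tau> +
  fixes p :: nat
  assumes prime_p: "Factorial_Ring.prime p"
    and tau_inj: "\<And>f. f \<in> M \<Longrightarrow> \<tau> f = 0 \<Longrightarrow> f = 0"
    and p_mult_tau: "\<And>f. f \<in> M \<Longrightarrow> \<exists>g\<in>M. of_nat p * f = \<tau> g"
    and tau_power_p_mult: "\<And>f. f \<in> M \<Longrightarrow> \<exists>g\<in>M. (\<tau> ^^ (p - 1)) f = of_nat p * g"
    and p_separated: "\<And>f. f \<in> M \<Longrightarrow> (\<And>k. \<exists>g. f = of_nat (p ^ k) * g) \<Longrightarrow> f = 0"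
begin

section \<open>The \<tau>-adic filtration on \<open>M\<close>\<close>

lemma tau_power_inj:
  assumes "f \<in> M" "g \<in> M" "(\<tau> ^^ n) f = (\<tau> ^^ n) g"
  shows "f = g"
proof -
  have "h = 0" if "h \<in> M" "(\<tau> ^^ n) h = 0" for h
    using that by (induction n) (auto dest!: tau_inj[rotated] intro: \<tau>.mem_intros)
  from this[of "f - g"] show ?thesis using assms by (simp add: \<tau>.Dpow_simps \<tau>.mem_intros)
qed

text \<open>As \<tau> ^ (p - 1) maps \<open>M\<close> into \<open>p M\<close>, divisibility by all
  powers of \<tau> forces divisibility by all powers of \<open>p\<close>.\<close>

lemma tau_separated:
  assumes "f \<in> M" "\<And>j. \<exists>g\<in>M. f = (\<tau> ^^ j) g"
  shows "f = 0"
proof (rule p_separated)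
  fix k
  have "\<exists>g\<in>M. (\<tau> ^^ ((p - 1) * k)) h = of_nat (p ^ k) * g" if "h \<in> M" for h
    using that
  proof (induction k arbitrary: h)
    case (Suc k)
    then obtain g where g: "g \<in> M" "(\<tau> ^^ (p - 1)) h = of_nat p * g" using tau_power_p_mult by blast
    obtain g' where g': "g' \<in> M" "(\<tau> ^^ ((p - 1) * k)) g = of_nat (p ^ k) * g'" using Suc.IH[OF g(1)] by blast
    have "(\<tau> ^^ ((p - 1) * Suc k)) h = (\<tau> ^^ ((p - 1) * k)) ((\<tau> ^^ (p - 1)) h)"
      by (metis mult_Suc_right add.commute comp_apply funpow_add)
    also have "\<dots> = of_nat (p ^ Suc k) * g'"
      using g'(2) by (simp only: g(2) \<tau>.Dpow_simps) (simp add: mult_ac)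
    finally show ?case using g' by blast
  qed auto
  then show "\<exists>g. f = of_nat (p ^ k) * g" using assms(2)[of "(p - 1) * k"] by metis
qed fact

text \<open>This is the congruence of \<open>D\<close> to 0 modulo \<tau> ^ j. Commutation with
  \<tau> makes the powers of \<tau> accumulate when \<open>D\<close> is iterated.\<close>

definition tau_level :: "nat \<Rightarrow> ('m \<Rightarrow> 'm) \<Rightarrow> bool" where
  "tau_level j D \<longleftrightarrow> stable_operator M D \<and> (\<forall>f\<in>M. D (\<tau> f) = \<tau> (D f)) \<and> (\<forall>f\<in>M. \<exists>g\<in>M. D f = (\<tau> ^^ j) g)"

lemma tau_level_commute:
  assumes "tau_level j D" "f \<in> M"
  shows "D ((\<tau> ^^ n) f) = (\<tau> ^^ n) (D f)"
  using assms(2) by (induction n) (use assms(1) in \<open>auto simp: tau_level_def \<tau>.mem_intros\<close>)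

lemma tau_level_power:
  assumes "tau_level j D" "f \<in> M"
  shows "\<exists>g\<in>M. (D ^^ n) f = (\<tau> ^^ (j * n)) g"
proof (induction n)
  case (Suc n)
  then obtain g where g: "g \<in> M" "(D ^^ n) f = (\<tau> ^^ (j * n)) g" by blast
  then obtain h where "h \<in> M" "D g = (\<tau> ^^ j) h" using assms by (auto simp: tau_level_def)
  then show ?case using g tau_level_commute[OF assms(1) g(1)]
    by (auto intro!: bexI[of _ h] simp: funpow_add add.commute[of j] )
qed (use assms in auto)

lemma tau_power_mono:
  assumes "g \<in> M" "i \<le> j"
  shows "\<exists>h\<in>M. (\<tau> ^^ j) g = (\<tau> ^^ i) h"
proof -
  have "(\<tau> ^^ j) g = (\<tau> ^^ i) ((\<tau> ^^ (j - i)) g)"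
    using assms funpow_add[of i "j - i" \<tau>] by simp
  then show ?thesis using assms by (auto intro: \<tau>.mem_intros)
qed

lemma tau_level_mono: "tau_level j D \<Longrightarrow> i \<le> j \<Longrightarrow> tau_level i D"
  unfolding tau_level_def by (metis tau_power_mono)

text \<open>Expanding \<open>(1 + D) ^ m = 1\<close> puts \<open>m D f\<close> into
  \<open>D ^ 2 M\<close>, hence into \<tau> ^ (2 j) \<open>M\<close>; and \<open>p D f\<close> gains
  a further \<tau> from \<open>p\<close>. A Bezout relation between \<open>m\<close> and
  \<open>p\<close> recovers \<open>D f\<close>.\<close>

lemma tau_level_Suc_of_coprime_torsion:
  assumes lev: "tau_level j D" and "1 \<le> j" and "coprime m p"
    and tors: "\<And>f. f \<in> M \<Longrightarrow> ((\<lambda>f. f + D f) ^^ m) f = f"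
  shows "tau_level (Suc j) D"
proof -
  interpret D: stable_operator M D using lev by (simp add: tau_level_def)
  have "\<exists>g\<in>M. D f = (\<tau> ^^ Suc j) g" if f: "f \<in> M" for f
  proof -
    obtain g where g: "g \<in> M" "f = f + of_nat m * D f + D (D g)"
      using D.one_plus_power_linear_term[OF f, of m] tors[OF f] by auto
    obtain g1 where g1: "g1 \<in> M" "(D ^^ 2) g = (\<tau> ^^ (j * 2)) g1"
      using tau_level_power[OF lev g(1)] by blast
    obtain g2 where g2: "g2 \<in> M" "(\<tau> ^^ (j * 2)) g1 = (\<tau> ^^ Suc j) g2"
      using tau_power_mono[OF g1(1), of "Suc j" "j * 2"] \<open>1 \<le> j\<close> by auto
    have m: "of_nat m * D f = - (\<tau> ^^ Suc j) g2"
      using g(2) g1(2) g2(2) by (simp add: numeral_2_eq_2 add.assoc eq_neg_iff_add_eq_0)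
    obtain h where h: "h \<in> M" "D f = (\<tau> ^^ j) h" using lev f by (auto simp: tau_level_def)
    obtain h' where h': "h' \<in> M" "of_nat p * h = \<tau> h'" using p_mult_tau[OF h(1)] by blast
    have p: "of_nat p * D f = (\<tau> ^^ Suc j) h'"
      using h h' \<tau>.Dpow_simps(4)[of j p h] by (simp add: funpow_swap1)
    have "m \<noteq> 0" using \<open>coprime m p\<close> prime_p by (auto intro: ccontr)
    then obtain a b where ab: "m * a = p * b + 1"
      using bezout_nat[of m p] \<open>coprime m p\<close> by auto
    have "D f = of_nat (m * a) * D f - of_nat (p * b) * D f" unfolding ab by (simp add: distrib_right)
    also have "\<dots> = of_nat a * (of_nat m * D f) - of_nat b * (of_nat p * D f)" by (simp add: mult_ac)
    also have "\<dots> = (\<tau> ^^ Suc j) (0 - of_nat a * g2 - of_nat b * h')"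
      unfolding m p by (simp only: \<tau>.Dpow_simps) simp
    finally show ?thesis using g2 h' by (blast intro: \<tau>.mem_intros)
  qed
  then show ?thesis using lev by (simp add: tau_level_def)
qed

text \<open>Expanding \<open>(1 + D) ^ p = 1\<close> gives \<open>p D (1 + D c) = - D ^ p\<close>. Iterating, \<open>p D\<close> maps \<open>M\<close> into
  \<open>D ^ p M\<close>, hence into \<open>\<tau> ^ (j p) M\<close>, and cancelling \<open>p \<sim> \<tau> ^ (p - 1)\<close> raises the level of \<open>D\<close> as soon as
  \<open>j \<ge> 2\<close>.\<close>

lemma tau_level_Suc_of_p_torsion:
  assumes lev: "tau_level j D" and "2 \<le> j"
    and tors: "\<And>f. f \<in> M \<Longrightarrow> ((\<lambda>f. f + D f) ^^ p) f = f"
  shows "tau_level (Suc j) D"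
proof -
  interpret D: stable_operator M D using lev by (simp add: tau_level_def)
  have p2: "p \<ge> 2" using prime_p by (rule prime_ge_2_nat)
  have pD: "\<exists>g\<in>M. of_nat p * D f = (0 - of_nat p * D (D g)) - (D ^^ p) f" if f: "f \<in> M" for f
  proof -
    obtain g where g: "g \<in> M" "f = f + of_nat p * (D f + D (D g)) + (D ^^ p) f"
      using D.one_plus_prime_power[OF prime_p f] tors[OF f] by auto
    then have "of_nat p * D f + of_nat p * D (D g) + (D ^^ p) f = 0" by (simp add: algebra_simps)
    then show ?thesis using g(1) by (intro bexI[of _ g]) (auto simp: algebra_simps eq_neg_iff_add_eq_0)
  qed
  \<comment> \<open>Substituting \<open>pD\<close> into the first summand raises the power of
    \<open>D\<close> there by one and collects the rest in \<open>D ^ p M\<close>.\<close>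
  have "\<exists>g\<in>M. \<exists>g'\<in>M. of_nat p * D f = of_nat p * (D ^^ Suc k) g + (D ^^ p) g'" if f: "f \<in> M" for f k
  proof (induction k)
    case 0
    show ?case using f by (intro bexI[of _ f] bexI[of _ 0]) (auto simp: D.Dpow_simps D.mem_intros)
  next
    case (Suc k)
    then obtain g g' where g: "g \<in> M" "g' \<in> M" "of_nat p * D f = of_nat p * (D ^^ Suc k) g + (D ^^ p) g'"
      by blast
    obtain h where h: "h \<in> M" "of_nat p * D g = (0 - of_nat p * D (D h)) - (D ^^ p) g"
      using pD[OF g(1)] by blast
    have "of_nat p * (D ^^ Suc k) g = (D ^^ k) (of_nat p * D g)"
      by (simp add: D.Dpow_simps funpow_swap1)
    also have "\<dots> = (0 - of_nat p * (D ^^ k) (D (D h))) - (D ^^ k) ((D ^^ p) g)"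
      unfolding h(2) by (simp only: D.Dpow_simps)
    also have "(D ^^ k) (D (D h)) = (D ^^ Suc (Suc k)) h" by (simp add: funpow_swap1)
    also have "(D ^^ k) ((D ^^ p) g) = (D ^^ p) ((D ^^ k) g)"
      by (metis add.commute comp_apply funpow_add)
    finally have "of_nat p * D f = of_nat p * (D ^^ Suc (Suc k)) (0 - h) + (D ^^ p) (g' - (D ^^ k) g)"
      unfolding g(3) by (simp only: D.Dpow_simps) (simp add: algebra_simps)
    moreover have "0 - h \<in> M" "g' - (D ^^ k) g \<in> M" using g h by (auto intro!: D.mem_intros simp del: diff_0)
    ultimately show ?case by blast
  qed
  note step = this
  have pD': "\<exists>g\<in>M. of_nat p * D f = (\<tau> ^^ (j * p)) g" if f: "f \<in> M" for f
  proof -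
    \<comment> \<open>At \<open>k = p - 1\<close> the first summand lies in \<open>D ^ p M\<close>
      as well.\<close>
    obtain g g' where g: "g \<in> M" "g' \<in> M" "of_nat p * D f = of_nat p * (D ^^ Suc (p - 1)) g + (D ^^ p) g'"
      using step[OF f, of "p - 1"] by blast
    then have "of_nat p * D f = (D ^^ p) (of_nat p * g + g')"
      using p2 by (simp add: D.Dpow_simps del: funpow.simps)
    then show ?thesis using tau_level_power[OF lev, of "of_nat p * g + g'" p] g by (auto intro: D.mem_intros)
  qed
  have "\<exists>g\<in>M. D f = (\<tau> ^^ Suc j) g" if f: "f \<in> M" for f
  proof -
    obtain h where h: "h \<in> M" "(\<tau> ^^ (p - 1)) f = of_nat p * h" using tau_power_p_mult[OF f] by blast
    obtain g where g: "g \<in> M" "of_nat p * D h = (\<tau> ^^ (j * p)) g" using pD'[OF h(1)] by blast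
    \<comment> \<open>Equivalent to (j - 1)(p - 1) being at least 1; here \<open>j\<close> must be
      at least 2.\<close>
    have "Suc j + (p - 1) \<le> j * p"
    proof -
      obtain i q where "j = i + 2" "p = q + 2" using \<open>2 \<le> j\<close> p2 by (metis le_add_diff_inverse2)
      then show ?thesis by simp
    qed
    then obtain g' where g': "g' \<in> M" "(\<tau> ^^ (j * p)) g = (\<tau> ^^ ((p - 1) + Suc j)) g'"
      using tau_power_mono[OF g(1)] by (metis add.commute)
    have "(\<tau> ^^ (p - 1)) (D f) = D (of_nat p * h)" using tau_level_commute[OF lev f] h by metis
    also have "\<dots> = (\<tau> ^^ (p - 1)) ((\<tau> ^^ Suc j) g')"
      using g(2) g'(2) by (simp only: D.D_simps funpow_add comp_apply)
    finally have "D f = (\<tau> ^^ Suc j) g'"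
      by (rule tau_power_inj[rotated 2]) (use f g' in \<open>auto intro: D.mem_intros \<tau>.mem_intros\<close>)
    then show ?thesis using g' by blast
  qed
  then show ?thesis using lev by (simp add: tau_level_def)
qed

lemma eq_zero_if_tau_levels:
  assumes "\<And>j. j \<ge> i \<Longrightarrow> tau_level j D \<Longrightarrow> tau_level (Suc j) D" and "tau_level i D" and "f \<in> M"
  shows "D f = 0"
proof (rule tau_separated)
  have lev: "tau_level j D" if "j \<ge> i" for j
    using that by (induction rule: dec_induct) (use assms in auto)
  fix j
  show "\<exists>g\<in>M. D f = (\<tau> ^^ j) g"
    using tau_level_mono[OF lev, of "max i j" j] assms(3) by (auto simp: tau_level_def)
qed (use assms in \<open>auto simp: tau_level_def stable_operator_def\<close>)

text \<open>By the linear expansion, \<open>(1 + D) ^ n - 1\<close> has its values in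
  \<open>D M\<close>, so it inherits the level. This lets an induction pass from an operator to its
  power.\<close>

lemma tau_level_diff:
  assumes "tau_level j D" 
  shows "tau_level j (\<lambda>f. ((\<lambda>f. f + D f) ^^ n) f - f)"
proof -
  interpret D: stable_operator M D using assms by (simp add: tau_level_def)
  let ?v = "\<lambda>f. f + D f"
  have v: "additive ?v" by (simp add: additive_def D.D_simps algebra_simps)
  have mem: "(?v ^^ n) f \<in> M" if "f \<in> M" for f
    using that by (induction n) (auto intro: D.mem_intros)
  have comm: "(?v ^^ n) (\<tau> f) = \<tau> ((?v ^^ n) f)" if "f \<in> M" for f
    using that
  proof (induction n arbitrary: f)
    case (Suc n)
    then show ?case using assms D.D_mem D.add_mem
      by (simp add: funpow_swap1 tau_level_def \<tau>.D_simps[symmetric] del: funpow.simps add: funpow_Suc_right)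
  qed simp
  have lev: "\<exists>g\<in>M. (?v ^^ n) f - f = (\<tau> ^^ j) g" if f: "f \<in> M" for f
  proof -
    obtain g where g: "g \<in> M" "(?v ^^ n) f = f + of_nat n * D f + D (D g)"
      using D.one_plus_power_linear_term[OF f] by blast
    then have "(?v ^^ n) f - f = D (of_nat n * f + D g)" by (simp add: D.D_simps)
    moreover have "of_nat n * f + D g \<in> M" using f g by (intro D.mem_intros)
    ultimately show ?thesis using assms by (auto simp: tau_level_def)
  qed
  show ?thesis
    unfolding tau_level_def
    using additive.add[OF additive_funpow[OF v, of n]] comm lev mem
    by (auto simp: stable_operator_def additive_def \<tau>.D_simps intro: D.mem_intros)
qed

text \<open>Strong induction on \<open>n\<close>, with \<open>v = 1 + D\<close>. If \<open>p\<close>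
  does not divide \<open>n\<close>, the coprime case raises the level forever. Otherwise
  \<open>v ^ p\<close> has the smaller exponent \<open>n / p\<close> and is trivial by induction, so
  the case of \<open>p\<close>-torsion applies to \<open>v\<close>.\<close>

lemma trivial_of_level_two_torsion:
  assumes "tau_level 2 D" and "n > 0"
    and "\<And>f. f \<in> M \<Longrightarrow> ((\<lambda>f. f + D f) ^^ n) f = f" and "f \<in> M"
  shows "D f = 0"
  using assms
proof (induction n arbitrary: D f rule: less_induct)
  case (less n)
  show ?case
  proof (cases "p dvd n")
    case False
    then have "coprime n p" using prime_p by (metis coprime_commute prime_imp_coprime)
    then show ?thesis
      using less.prems(3)
      by (intro eq_zero_if_tau_levels[of 2 D f] tau_level_Suc_of_coprime_torsion[where m = n] less.prems(1,4)) auto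
  next
    case True
    then obtain m where m: "n = p * m" by blast
    let ?E = "\<lambda>f. ((\<lambda>f. f + D f) ^^ p) f - f"
    have "((\<lambda>f. f + ?E f) ^^ m) g = g" if "g \<in> M" for g
      using less.prems(3)[OF that] by (simp add: m funpow_mult mult.commute)
    moreover have "0 < m" "m < n" using \<open>n > 0\<close> m prime_gt_1_nat[OF prime_p] by auto
    ultimately have "?E g = 0" if "g \<in> M" for g
      using less.IH[of m ?E g] tau_level_diff[OF less.prems(1), of p] that by simp
    then show ?thesis
      by (intro eq_zero_if_tau_levels[of 2 D f] tau_level_Suc_of_p_torsion less.prems(1,4)) auto
  qed
qed

text \<open>In \<open>v ^ p - 1\<close>, the part \<open>p D (f + D g)\<close> gains one \<tau> from
  \<open>p\<close> and one from \<open>D\<close>, and \<open>D ^ p f\<close> gains \<open>p\<close>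
  of them. Hence \<open>v ^ p - 1\<close> has level 2.\<close>

theorem torsion_power_p_trivial:
  assumes lev: "tau_level 1 D" and "n > 0"
    and tors: "\<And>f. f \<in> M \<Longrightarrow> ((\<lambda>f. f + D f) ^^ n) f = f" and "f \<in> M"
  shows "((\<lambda>f. f + D f) ^^ p) f = f"
proof -
  interpret D: stable_operator M D using lev by (simp add: tau_level_def)
  let ?v = "\<lambda>f. f + D f"
  let ?E = "\<lambda>f. (?v ^^ p) f - f"
  have "\<exists>g\<in>M. ?E f = (\<tau> ^^ 2) g" if f: "f \<in> M" for f
  proof -
    obtain g where g: "g \<in> M" "(?v ^^ p) f = f + of_nat p * (D f + D (D g)) + (D ^^ p) f"
      using D.one_plus_prime_power[OF prime_p f] by blast
    have fg: "f + D g \<in> M" using f g by (intro D.mem_intros)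
    then obtain h where h: "h \<in> M" "D (f + D g) = \<tau> h" using lev by (auto simp: tau_level_def)
    obtain h' where h': "h' \<in> M" "of_nat p * h = \<tau> h'" using p_mult_tau[OF h(1)] by blast
    obtain k where k: "k \<in> M" "(D ^^ p) f = (\<tau> ^^ p) k" using tau_level_power[OF lev f, of p] by auto
    obtain k' where k': "k' \<in> M" "(\<tau> ^^ p) k = (\<tau> ^^ 2) k'"
      using tau_power_mono[OF k(1) prime_ge_2_nat[OF prime_p]] by blast
    have "?E f = of_nat p * D (f + D g) + (D ^^ p) f" using g(2) by (simp add: D.D_simps)
    also have "of_nat p * D (f + D g) = (\<tau> ^^ 2) h'"
      using h h' by (simp add: \<tau>.D_simps(5)[symmetric] numeral_2_eq_2)
    finally have "?E f = (\<tau> ^^ 2) (h' + k')" using k k' by (simp add: \<tau>.Dpow_simps)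
    then show ?thesis using h' k' by (blast intro: D.mem_intros)
  qed
  then have "tau_level 2 ?E" using tau_level_diff[OF lev, of p] by (simp add: tau_level_def)
  moreover have "((\<lambda>f. f + ?E f) ^^ n) g = g" if "g \<in> M" for g
  proof -
    have "((\<lambda>f. f + ?E f) ^^ n) g = ((?v ^^ n) ^^ p) g" by (simp add: funpow_mult mult.commute)
    also have "\<dots> = g" by (induction p) (simp_all add: tors that)
    finally show ?thesis .
  qed
  ultimately have "?E f = 0" using trivial_of_level_two_torsion[of ?E n f] assms by blast
  then show ?thesis by simp
qed

end

section \<open>Extensions of prime index\<close>

definition right_invariant :: "('a, 'b) monoid_scheme \<Rightarrow> 'a set \<Rightarrow> ('a \<Rightarrow> int) set" where
  "right_invariant G H = {f. grp_ring_elem G f \<and> (\<forall>x\<in>carrier G. \<forall>h\<in>H. f (x \<otimes>\<^bsub>G\<^esub> h) = f x)}"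

definition right_shift :: "('a, 'b) monoid_scheme \<Rightarrow> 'a \<Rightarrow> ('a \<Rightarrow> int) \<Rightarrow> ('a \<Rightarrow> int)" where
  "right_shift G t f = (\<lambda>x. if x \<in> carrier G then f (x \<otimes>\<^bsub>G\<^esub> t) else 0)"

lemma additive_right_shift: "additive (right_shift G t)"
  by (auto simp: additive_def right_shift_def)

text \<open>The product is pointwise, not convolution; it is the one used in the contracting
  homotopy for the norm.\<close>

lemma right_shift_mult: "right_shift G t (f * g) = right_shift G t f * right_shift G t g"
  by (auto simp: right_shift_def)

lemma additive_grp_ring_mult: "additive (grp_ring_mult G u)"
  by (auto simp: additive_def grp_ring_mult_def fun_eq_iff distrib_left sum.distrib)

lemma sum_fun_apply: "(\<Sum>i\<in>I. f i) x = (\<Sum>i\<in>I. f i x)"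
  by (induction I rule: infinite_finite_induct) simp_all

lemma right_invariant_closed:
  assumes "f \<in> right_invariant G H" "g \<in> right_invariant G H"
  shows "f - g \<in> right_invariant G H" "f + g \<in> right_invariant G H" "f * g \<in> right_invariant G H"
  using assms by (auto simp: right_invariant_def grp_ring_elem_def)

lemma zero_mem_right_invariant: "0 \<in> right_invariant G H"
  by (simp add: right_invariant_def grp_ring_elem_def)

lemma sum_mem_right_invariant:
  "(\<And>i. i \<in> I \<Longrightarrow> f i \<in> right_invariant G H) \<Longrightarrow> (\<Sum>i\<in>I. f i) \<in> right_invariant G H"
  by (induction I rule: infinite_finite_induct) (simp_all add: zero_mem_right_invariant right_invariant_closed)

lemma sum_dvd_indicator:
  fixes p m :: nat
  assumes "p > 0"
  shows "(\<Sum>i<p. if p dvd m + i then 1 else 0) = (1 :: int)"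
proof -
  \<comment> \<open>The unique index below \<open>p\<close> that completes \<open>m\<close> to a
    multiple of \<open>p\<close>; the outer \<open>mod\<close> turns \<open>p\<close> into 0 when
    \<open>p\<close> divides \<open>m\<close>.\<close>
  define r where "r = (p - m mod p) mod p"
  have "m + i = p * (m div p) + (m mod p + i)" for i by simp
  then have *: "p dvd m + i \<longleftrightarrow> p dvd m mod p + i" for i by (metis dvd_add_right_iff dvd_triv_left)
  have "p dvd m + i \<longleftrightarrow> i = r" if "i < p" for i
  proof -
    have "m mod p < p" using assms by simp
    have "m mod p + i = 0 \<or> m mod p + i = p" if dvd: "p dvd m mod p + i"
    proof -
      obtain c where c: "m mod p + i = p * c" using dvd by (elim dvdE)
      then have "p * c < p * 2" using \<open>m mod p < p\<close> \<open>i < p\<close> by linarith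
      then have "c = 0 \<or> c = 1" by auto
      then show ?thesis using c by auto
    qed
    then have "p dvd m mod p + i \<longleftrightarrow> m mod p + i = 0 \<or> m mod p + i = p" by auto
    then show ?thesis unfolding * r_def using that \<open>m mod p < p\<close>
      by (cases "m mod p = 0") auto
  qed
  then have "(\<Sum>i<p. if p dvd m + i then 1 else 0) = (\<Sum>i<p. if i = r then 1 else (0::int))"
    by (intro sum.cong) auto
  then show ?thesis using assms by (simp add: r_def)
qed

lemma int_eq_zero_if_prime_powers_dvd:
  fixes a :: int
  assumes "p > 1" "\<And>k. int (p ^ k) dvd a"
  shows "a = 0"
proof (rule ccontr)
  assume "a \<noteq> 0"
  have "int (p ^ nat \<bar>a\<bar>) \<le> \<bar>a\<bar>"
    using dvd_imp_le_int[OF \<open>a \<noteq> 0\<close> assms(2)[of "nat \<bar>a\<bar>"]] by simp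
  moreover have "nat \<bar>a\<bar> < p ^ nat \<bar>a\<bar>" using assms(1) by (simp add: power_gt_expt)
  ultimately show False by linarith
qed

context group
begin

lemma grp_ring_mult_right_invariant:
  assumes "f \<in> right_invariant G H" "H \<subseteq> carrier G"
  shows "grp_ring_mult G u f \<in> right_invariant G H"
proof -
  have "f (inv y \<otimes> (x \<otimes> h)) = f (inv y \<otimes> x)" if "x \<in> carrier G" "y \<in> carrier G" "h \<in> H" for x y h
  proof -
    have "inv y \<otimes> (x \<otimes> h) = (inv y \<otimes> x) \<otimes> h" "inv y \<otimes> x \<in> carrier G"
      using that assms(2) by (auto simp: m_assoc subset_iff)
    then show ?thesis using that(3) assms(1) by (simp add: right_invariant_def)
  qed
  then show ?thesis using assms(2)
    by (auto simp: right_invariant_def grp_ring_elem_def grp_ring_mult_def subset_iff intro!: sum.cong)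
qed

lemma grp_ring_mult_right_shift:
  assumes "t \<in> carrier G"
  shows "grp_ring_mult G u (right_shift G t f) = right_shift G t (grp_ring_mult G u f)"
  using assms by (auto simp: grp_ring_mult_def right_shift_def fun_eq_iff m_assoc intro!: sum.cong)

text \<open>An element \<open>k\<close> is moved past \<open>t\<close> by replacing it with its
  conjugate under \<open>t\<close>, which lies in \<open>K\<close> again.\<close>

lemma right_shift_right_invariant:
  assumes "f \<in> right_invariant G K" "t \<in> carrier G" "K \<subseteq> carrier G" "\<And>k. k \<in> K \<Longrightarrow> inv t \<otimes> k \<otimes> t \<in> K"
  shows "right_shift G t f \<in> right_invariant G K"
proof -
  have "f (x \<otimes> k \<otimes> t) = f (x \<otimes> t)" if "x \<in> carrier G" "k \<in> K" for x k
  proof -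
    have k: "k \<in> carrier G" using that assms by auto
    have "x \<otimes> k \<otimes> t = (x \<otimes> t) \<otimes> (inv t \<otimes> k \<otimes> t)"
      using that k assms(2) by (simp add: m_assoc inv_solve_left' flip: m_assoc[of t "inv t"])
    then show ?thesis using that assms(1,2) assms(4)[OF that(2)] by (auto simp: right_invariant_def)
  qed
  then show ?thesis using assms by (auto simp: right_invariant_def right_shift_def grp_ring_elem_def subset_iff)
qed

lemma right_shift_funpow:
  assumes "grp_ring_elem G f" "t \<in> carrier G"
  shows "(right_shift G t ^^ i) f = right_shift G (t [^] i) f"
proof (induction i)
  case 0
  show ?case using assms by (auto simp: right_shift_def fun_eq_iff grp_ring_elem_def)
next
  case (Suc i)
  show ?case using assms Suc by (auto simp: right_shift_def fun_eq_iff m_assoc simp flip: nat_pow_Suc2)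
qed

text \<open>If \<open>p\<close> does not divide \<open>j\<close>, a relation
  \<open>j a = p b + 1\<close> would express \<open>t\<close> through \<open>t [^] j\<close> and
  \<open>t [^] p\<close>, hence put it into \<open>K\<close>.\<close>

lemma pow_mem_subgroup_iff:
  assumes "subgroup K G" "t \<in> carrier G" "t \<notin> K" "Factorial_Ring.prime p" "t [^] p \<in> K"
  shows "t [^] (j::nat) \<in> K \<longleftrightarrow> p dvd j"
proof
  interpret K: subgroup K G by fact
  have pow: "x [^] (n::nat) \<in> K" if "x \<in> K" for x n
    using that by (induction n) auto
  show "t [^] j \<in> K" if "p dvd j"
    using that pow[OF assms(5)] assms(2) by (auto simp: nat_pow_pow)
  show "p dvd j" if "t [^] j \<in> K"
  proof (rule ccontr)
    assume "\<not> p dvd j"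
    then have "coprime j p" "j \<noteq> 0" using prime_imp_coprime[OF assms(4), of j] by (auto simp: coprime_commute intro: ccontr)
    then obtain a b where ab: "j * a = p * b + 1" using bezout_nat[of j p] by auto
    have "t [^] (p * b) \<otimes> t = t [^] (j * a)" using assms(2) by (simp add: ab)
    then have "t = inv (t [^] (p * b)) \<otimes> t [^] (j * a)" using assms(2) by (simp add: inv_solve_left)
    moreover have "t [^] (p * b) \<in> K" "t [^] (j * a) \<in> K"
      using pow[OF assms(5)] pow[OF that] assms(2) by (simp_all add: nat_pow_pow)
    ultimately show False using assms(3) by (metis K.m_closed K.m_inv_closed)
  qed
qed

end

text \<open>\<open>K\<close> is normal in \<open>K'\<close> with cyclic quotient of order
  \<open>p\<close>, generated by the coset of \<open>t\<close>. Natural exponents suffice in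
  \<open>K'_elem\<close> because \<open>t [^] p\<close> lies in \<open>K\<close>.\<close>

locale prime_index_extension = group G for G (structure) +
  fixes K K' :: "'a set" and t :: 'a and p :: nat
  assumes subgroup_K: "subgroup K G" and subgroup_K': "subgroup K' G"
    and K_le: "K \<subseteq> K'" and t_mem: "t \<in> K'" and t_notin: "t \<notin> K"
    and prime_index: "Factorial_Ring.prime p" and t_pow: "t [^] p \<in> K"
    and normalizes: "\<And>k. k \<in> K \<Longrightarrow> inv t \<otimes> k \<otimes> t \<in> K"
    and K'_elem: "\<And>y. y \<in> K' \<Longrightarrow> \<exists>k\<in>K. \<exists>i::nat. y = k \<otimes> t [^] i"
begin

section \<open>Shift and norm for an extension of prime index\<close>

abbreviation "F \<equiv> right_invariant G K"
abbreviation "R \<equiv> right_shift G t"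
abbreviation "\<tau> f \<equiv> R f - f"
abbreviation "norm_R f \<equiv> (\<Sum>i<p. (R ^^ i) f)"

lemma t_carrier: "t \<in> carrier G"
  using t_mem subgroup_K' by (rule subgroup.mem_carrier[rotated])

lemma K_carrier: "K \<subseteq> carrier G" 
  using subgroup_K by (rule subgroup.subset)

lemma p_ge_2: "2 \<le> p"
  using prime_index by (rule prime_ge_2_nat)

lemmas R_simps = additive.add[OF additive_right_shift] additive.diff[OF additive_right_shift]
  additive.zero[OF additive_right_shift] additive.sum[OF additive_right_shift] right_shift_mult

lemma R_mem: "f \<in> F \<Longrightarrow> R f \<in> F"
  using right_shift_right_invariant[OF _ t_carrier K_carrier normalizes] .

lemma R_pow_mem: "f \<in> F \<Longrightarrow> (R ^^ i) f \<in> F"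
  by (induction i) (simp_all add: R_mem)

lemma R_pow_apply: "f \<in> F \<Longrightarrow> x \<in> carrier G \<Longrightarrow> (R ^^ i) f x = f (x \<otimes> t [^] i)"
  using right_shift_funpow[OF _ t_carrier] by (simp add: right_invariant_def right_shift_def)

lemma R_pow_p: "f \<in> F \<Longrightarrow> (R ^^ p) f = f"
  using right_shift_funpow[OF _ t_carrier, of f p] t_pow
  by (auto simp: right_invariant_def right_shift_def grp_ring_elem_def)

lemma norm_R_mem: "f \<in> F \<Longrightarrow> norm_R f \<in> F"
  by (intro sum_mem_right_invariant R_pow_mem)

lemma norm_R_diff: "norm_R (f - g) = norm_R f - norm_R g"
  by (simp add: additive.diff[OF additive_funpow[OF additive_right_shift]] sum_subtractf)

lemma norm_R_shift: "norm_R (R f) = R (norm_R f)"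
  by (simp add: R_simps funpow_swap1)

lemma R_norm_R: "f \<in> F \<Longrightarrow> R (norm_R f) = norm_R f"
proof -
  assume f: "f \<in> F"
  have "R (norm_R f) - norm_R f = (\<Sum>i<p. (R ^^ Suc i) f - (R ^^ i) f)"
    by (simp add: R_simps sum_subtractf)
  also have "\<dots> = (R ^^ p) f - f" by (subst sum_lessThan_telescope) simp
  finally show ?thesis using R_pow_p[OF f] by simp
qed

text \<open>\<open>K\<close> and \<open>t\<close> generate \<open>K'\<close>. This places norms in
  the lattice on which the operator is known to be trivial.\<close>

lemma mem_right_invariant_extension:
  assumes "f \<in> F" "R f = f"
  shows "f \<in> right_invariant G K'"
proof -
  have R_pow: "(R ^^ i) f = f" for i by (induction i) (simp_all add: assms)
  have "f (x \<otimes> y) = f x" if x: "x \<in> carrier G" and y: "y \<in> K'" for x y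
  proof -
    obtain k i where k: "k \<in> K" "y = k \<otimes> t [^] (i::nat)" using K'_elem[OF y] by blast
    have kc: "k \<in> carrier G" using k K_carrier by auto
    have "f (x \<otimes> y) = f (x \<otimes> k \<otimes> t [^] i)" using k kc x t_carrier by (simp add: m_assoc)
    also have "\<dots> = f (x \<otimes> k)" using R_pow_apply[OF assms(1), of "x \<otimes> k" i] R_pow x kc by simp
    also have "\<dots> = f x" using assms(1) x k by (auto simp: right_invariant_def)
    finally show ?thesis .
  qed
  then show ?thesis using assms(1) by (simp add: right_invariant_def)
qed

text \<open>Choose one coset of \<open>K\<close> inside each coset of \<open>K'\<close> and let
  \<open>e\<close> be the indicator of their union. \<open>R\<close> permutes the \<open>p\<close>
  cosets of \<open>K\<close> in a coset of \<open>K'\<close> cyclically, so the translates of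
  \<open>e\<close> sum to 1.\<close>

lemma exists_norm_one:
  "\<exists>e\<in>F. norm_R e = (\<lambda>x. if x \<in> carrier G then 1 else 0)"
proof
  define r where "r x = (SOME y. y \<in> x <# K')" for x
  define e where "e x = (if x \<in> carrier G \<and> inv (r x) \<otimes> x \<in> K then 1 else 0 :: int)" for x
  interpret K: subgroup K G by (rule subgroup_K)
  interpret K': subgroup K' G by (rule subgroup_K')
  have r_mem: "r x \<in> x <# K'" if "x \<in> carrier G" for x
    unfolding r_def using lcos_self[OF that subgroup_K'] by (rule someI)
  have r_carrier: "r x \<in> carrier G" if "x \<in> carrier G" for x
    using r_mem[OF that] that by (auto simp: l_coset_def)
  have r_cong: "r (x \<otimes> k) = r x" if "x \<in> carrier G" "k \<in> K'" for x k
  proof -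
    have "x \<otimes> k <# K' = x <# K'"
      using that l_repr_independence[OF _ _ subgroup_K', of "x \<otimes> k" x] by (auto simp: l_coset_def)
    then show ?thesis by (simp add: r_def)
  qed
  have mem_iff: "y \<otimes> k \<in> K \<longleftrightarrow> y \<in> K" if "y \<in> carrier G" "k \<in> K" for y k
    using that K.m_closed K.m_inv_closed
    by (metis K.mem_carrier inv_solve_right m_closed)
  have mem_iff': "k \<otimes> y \<in> K \<longleftrightarrow> y \<in> K" if "y \<in> carrier G" "k \<in> K" for y k
    using that K.m_closed K.m_inv_closed
    by (metis K.mem_carrier inv_solve_left m_closed)
  show e: "e \<in> F"
    using K_le
    by (auto simp: right_invariant_def grp_ring_elem_def e_def r_cong subset_iff mem_iff r_carrier simp flip: m_assoc)
  show "norm_R e = (\<lambda>x. if x \<in> carrier G then 1 else 0)"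
  proof
    fix x
    show "norm_R e x = (if x \<in> carrier G then 1 else 0)"
    proof (cases "x \<in> carrier G")
      case True
      obtain k' where k': "k' \<in> K'" "r x = x \<otimes> k'" using r_mem[OF True] by (auto simp: l_coset_def)
      have "inv (r x) \<otimes> x = inv k'" using k' True by (simp add: inv_mult_group m_assoc)
      then have "inv (r x) \<otimes> x \<in> K'" using k' by simp
      then obtain k m where k: "k \<in> K" "inv (r x) \<otimes> x = k \<otimes> t [^] (m::nat)" using K'_elem by blast
      \<comment> \<open>\<open>x \<otimes> t [^] i\<close> lies in the chosen coset of
        \<open>K\<close> exactly if \<open>t [^] (m + i)\<close> lies in \<open>K\<close>, which
        happens for one \<open>i\<close> below \<open>p\<close>.\<close>
      have "(R ^^ i) e x = (if p dvd m + i then 1 else 0)" for i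
      proof -
        have "t [^] i \<in> K'" using t_mem by (induction i) auto
        then have "(R ^^ i) e x = (if inv (r x) \<otimes> (x \<otimes> t [^] i) \<in> K then 1 else 0)"
          using True t_carrier by (simp add: R_pow_apply[OF e True] e_def r_cong)
        also have "inv (r x) \<otimes> (x \<otimes> t [^] i) = k \<otimes> t [^] (m + i)"
          using True t_carrier r_carrier[OF True] k
          by (simp add: m_assoc[symmetric]) (simp add: m_assoc nat_pow_mult)
        also have "\<dots> \<in> K \<longleftrightarrow> p dvd m + i"
          using mem_iff'[OF _ k(1)] t_carrier
            pow_mem_subgroup_iff[OF subgroup_K t_carrier t_notin prime_index t_pow] by simp
        finally show ?thesis .
      qed
      then show ?thesis using True sum_dvd_indicator[of p m] p_ge_2 by (simp add: sum_fun_apply)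
    next
      case False
      then show ?thesis using norm_R_mem[OF e] by (simp add: right_invariant_def grp_ring_elem_def)
    qed
  qed
qed

text \<open>Vanishing of the Tate cohomology of the free action of the cyclic group generated by \<open>R\<close>:
  multiplication by an element of norm one is a contracting homotopy.\<close>

lemma norm_R_zero_imp_tau_image:
  assumes f: "f \<in> F" and "norm_R f = 0"
  shows "\<exists>h\<in>F. f = \<tau> h"
proof -
  obtain e where e: "e \<in> F" "norm_R e = (\<lambda>x. if x \<in> carrier G then 1 else 0)"
    using exists_norm_one by blast
  \<comment> \<open>Partial sums of the norm: \<open>a 0 = 0\<close> and
    \<open>a p = norm_R f = 0\<close> remove the boundary terms of the telescoping sum.\<close>
  define a where "a i = (\<Sum>j<i. (R ^^ j) f)" for i
  have a_mem: "a i \<in> F" for i unfolding a_def using f by (intro sum_mem_right_invariant R_pow_mem)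
  have a_R: "R (a i) = a (Suc i) - f" for i
    unfolding a_def by (subst sum.lessThan_Suc_shift) (simp add: R_simps)
  \<comment> \<open>\<open>R (a i) = a (Suc i) - f\<close> shifts the index; the sign makes
    \<open>R h - h\<close> equal to \<open>f * norm_R e = f\<close>.\<close>
  define h where "h = 0 - (\<Sum>i<p. a i * (R ^^ i) e)"
  have "h \<in> F" unfolding h_def using e
    by (intro right_invariant_closed(1) zero_mem_right_invariant sum_mem_right_invariant
        right_invariant_closed(3) a_mem R_pow_mem)
  have "(\<Sum>i<p. a (Suc i) * (R ^^ Suc i) e) - (\<Sum>i<p. a i * (R ^^ i) e) = a p * (R ^^ p) e - a 0 * (R ^^ 0) e"
    by (subst sum_lessThan_telescope[symmetric]) (simp add: sum_subtractf)
  also have "\<dots> = 0" using assms(2) by (simp add: a_def)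
  finally have shift: "(\<Sum>i<p. a (Suc i) * (R ^^ Suc i) e) = (\<Sum>i<p. a i * (R ^^ i) e)" by simp
  have "R h = 0 - (\<Sum>i<p. (a (Suc i) - f) * (R ^^ Suc i) e)"
    unfolding h_def by (simp only: R_simps a_R funpow.simps comp_apply)
  also have "\<dots> = h + f * R (norm_R e)"
    by (simp only: left_diff_distrib sum_subtractf shift) (simp add: h_def R_simps sum_distrib_left)
  also have "R (norm_R e) = norm_R e" using e(1) by (rule R_norm_R)
  also have "f * norm_R e = f"
    using f e(2) by (auto simp: right_invariant_def grp_ring_elem_def fun_eq_iff)
  finally have "f = \<tau> h" by (metis add_diff_cancel_left')
  then show ?thesis using \<open>h \<in> F\<close> by blast
qed

abbreviation "M \<equiv> {f \<in> F. norm_R f = 0}"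

lemma stable_operator_tau: "stable_operator M \<tau>"
proof
  show "0 \<in> M" 
    by (simp add: zero_mem_right_invariant additive.zero[OF additive_funpow[OF additive_right_shift]])
  show "f - g \<in> M" if "f \<in> M" "g \<in> M" for f g
    using that by (simp add: norm_R_diff right_invariant_closed)
  show "\<tau> (f + g) = \<tau> f + \<tau> g" for f g by (simp add: R_simps)
  show "\<tau> f \<in> M" if "f \<in> M" for f
    using that by (simp add: norm_R_diff norm_R_shift right_invariant_closed R_mem R_simps(3))
qed

text \<open>Expanding \<open>R ^ p = (1 + \<tau>) ^ p = 1\<close> and cancelling one \<tau> gives a
  relation \<open>p (f + \<tau> g) + \<tau> ^ (p - 1) f = 0\<close>. It yields both comparisons
  between \<open>p\<close> and \<tau>.\<close>

lemma tau_adic_norm_kernel: "tau_adic M \<tau> p"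
proof -
  interpret \<tau>: stable_operator M \<tau> by (rule stable_operator_tau)
  have inj: "f = 0" if f: "f \<in> M" and "\<tau> f = 0" for f
  proof -
    \<comment> \<open>An element fixed by \<open>R\<close> has norm \<open>p f\<close>, so a fixed
      element of norm zero vanishes.\<close>
    have "(R ^^ i) f = f" for i by (induction i) (use \<open>\<tau> f = 0\<close> in auto)
    then have "of_nat p * f = 0" using f by simp
    then show ?thesis using p_ge_2 by (auto simp: fun_eq_iff)
  qed
  have rel: "\<exists>g\<in>M. of_nat p * (f + \<tau> g) + (\<tau> ^^ (p - 1)) f = 0" if f: "f \<in> M" for f
  proof -
    obtain g where g: "g \<in> M"
      "((\<lambda>f. f + \<tau> f) ^^ p) f = f + of_nat p * (\<tau> f + \<tau> (\<tau> g)) + (\<tau> ^^ p) f"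
      using \<tau>.one_plus_prime_power[OF prime_index f] by blast
    have "((\<lambda>f. f + \<tau> f) ^^ p) f = f" using R_pow_p f by simp
    moreover have "(\<tau> ^^ p) f = \<tau> ((\<tau> ^^ (p - 1)) f)"
      using p_ge_2 by (cases p) auto
    ultimately have "of_nat p * (\<tau> f + \<tau> (\<tau> g)) + \<tau> ((\<tau> ^^ (p - 1)) f) = 0"
      using g(2) by (simp add: add.assoc)
    then have "\<tau> (of_nat p * (f + \<tau> g) + (\<tau> ^^ (p - 1)) f) = 0"
      by (simp only: \<tau>.D_simps)
    moreover have "of_nat p * (f + \<tau> g) + (\<tau> ^^ (p - 1)) f \<in> M"
      using f g(1) by (intro \<tau>.mem_intros)
    ultimately show ?thesis using inj g(1) by blast
  qed
  show ?thesis
  proof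
    show "\<exists>g\<in>M. of_nat p * f = \<tau> g" if f: "f \<in> M" for f
    proof -
      obtain g where g: "g \<in> M" "of_nat p * (f + \<tau> g) + (\<tau> ^^ (p - 1)) f = 0" using rel[OF f] by blast
      have "(\<tau> ^^ (p - 1)) f = \<tau> ((\<tau> ^^ (p - 2)) f)"
      proof -
        have "p - 1 = Suc (p - 2)" using p_ge_2 by simp
        then show ?thesis by simp
      qed
      with g(2) have "of_nat p * f = 0 - of_nat p * \<tau> g - \<tau> ((\<tau> ^^ (p - 2)) f)"
        by (simp only: distrib_left) (simp only: add.assoc add_eq_0_iff2 diff_0 minus_add uminus_add_conv_diff)
      also have "\<dots> = \<tau> (0 - of_nat p * g - (\<tau> ^^ (p - 2)) f)" by (simp only: \<tau>.D_simps)
      finally have "of_nat p * f = \<tau> (0 - of_nat p * g - (\<tau> ^^ (p - 2)) f)" .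
      moreover have "0 - of_nat p * g - (\<tau> ^^ (p - 2)) f \<in> M" using f g(1) by (intro \<tau>.mem_intros)
      ultimately show ?thesis by (rule bexI)
    qed
    show "\<exists>g\<in>M. (\<tau> ^^ (p - 1)) f = of_nat p * g" if f: "f \<in> M" for f
    proof -
      obtain g where g: "g \<in> M" "of_nat p * (f + \<tau> g) + (\<tau> ^^ (p - 1)) f = 0" using rel[OF f] by blast
      then have "(\<tau> ^^ (p - 1)) f = of_nat p * (0 - (f + \<tau> g))"
        by (simp only: right_diff_distrib) (simp only: add_eq_0_iff diff_0 mult_zero_right)
      moreover have "0 - (f + \<tau> g) \<in> M" using f g(1) by (intro \<tau>.mem_intros)
      ultimately show ?thesis by blast
    qed
    show "f = 0" if "f \<in> M" and dvd: "\<And>k. \<exists>g. f = of_nat (p ^ k) * g" for f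
    proof
      fix x
      have "int (p ^ k) dvd f x" for k
        using dvd[of k] by (metis dvd_triv_left of_nat_fun_apply times_fun_apply)
      then show "f x = 0 x" using int_eq_zero_if_prime_powers_dvd[of p "f x"] p_ge_2 by simp
    qed
    show "Factorial_Ring.prime p" by (rule prime_index)
    show "f = 0" if "f \<in> M" "\<tau> f = 0" for f using that by (rule inj)
  qed
qed

theorem torsion_power_p_trivial_on_right_invariant:
  assumes additive_V: "additive V"
    and V_mem: "\<And>f. f \<in> F \<Longrightarrow> V f \<in> F"
    and V_R: "\<And>f. V (R f) = R (V f)"
    and trivial: "\<And>f. f \<in> right_invariant G K' \<Longrightarrow> V f = f"
    and "n > 0" and torsion: "\<And>f. f \<in> F \<Longrightarrow> (V ^^ n) f = f"
    and f: "f \<in> F"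
  shows "(V ^^ p) f = f"
proof -
  interpret tau_adic M \<tau> p by (rule tau_adic_norm_kernel)
  note V_simps = additive.add[OF additive_V] additive.diff[OF additive_V] additive.zero[OF additive_V]
    additive.sum[OF additive_V]
  have V_R_pow: "V ((R ^^ i) f) = (R ^^ i) (V f)" for i f
    by (induction i) (simp_all add: V_R)
  have V_norm: "norm_R (V f) = norm_R f" if "f \<in> F" for f
  proof -
    have "norm_R (V f) = V (norm_R f)" by (simp add: V_simps V_R_pow)
    also have "\<dots> = norm_R f"
      using that by (intro trivial mem_right_invariant_extension norm_R_mem R_norm_R)
    finally show ?thesis .
  qed
  define D where "D f = V f - f" for f
  have VD: "V = (\<lambda>f. f + D f)" by (simp add: D_def)
  have D_mem: "D f \<in> M" if "f \<in> F" for f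
    using that by (simp add: D_def V_norm norm_R_diff right_invariant_closed V_mem)
  have D_add: "additive D" by (simp add: additive_def D_def V_simps)
  have lev: "tau_level 1 D"
  proof -
    have "\<exists>g\<in>M. D f = \<tau> g" if f: "f \<in> M" for f
    proof -
      \<comment> \<open>It suffices that \<open>h\<close> lies in \<open>F\<close>: \<open>D\<close>
        maps all of \<open>F\<close> into \<open>M\<close>.\<close>
      obtain h where h: "h \<in> F" "f = \<tau> h" using norm_R_zero_imp_tau_image f by blast
      then have "D f = \<tau> (D h)" by (simp add: D_def V_simps V_R R_simps)
      then show ?thesis using D_mem[OF h(1)] by blast
    qed
    moreover have "D (\<tau> f) = \<tau> (D f)" for f by (simp add: D_def V_simps V_R R_simps)
    moreover have "stable_operator M D"
      using \<tau>.zero_mem \<tau>.diff_mem D_add D_mem by unfold_locales (auto simp: additive_def)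
    ultimately show ?thesis by (simp add: tau_level_def)
  qed
  have V_pow_M: "(V ^^ p) g = g" if "g \<in> M" for g
    unfolding VD
    by (rule torsion_power_p_trivial[OF lev \<open>n > 0\<close> _ that]) (use torsion in \<open>simp add: VD[symmetric]\<close>)
  define E where "E f = (V ^^ p) f - f" for f
  have V_pow_mem: "(V ^^ i) f \<in> F" if "f \<in> F" for i f
    using that by (induction i) (simp_all add: V_mem)
  have V_pow_norm: "norm_R ((V ^^ i) f) = norm_R f" if "f \<in> F" for i f
    by (induction i) (simp_all add: V_norm V_pow_mem that)
  have E_mem: "E f \<in> M" if "f \<in> F" for f
    using that by (simp add: E_def V_pow_norm norm_R_diff right_invariant_closed V_pow_mem)
  interpret E: stable_operator F E
    by unfold_locales
      (use E_mem in \<open>auto simp: zero_mem_right_invariant right_invariant_closed E_def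
        additive.add[OF additive_funpow[OF additive_V]]\<close>)
  \<comment> \<open>\<open>E\<close> squares to zero on \<open>F\<close>, so the \<open>n\<close>-th power of \<open>V ^^ p = 1 + E\<close> is \<open>1 + n E\<close>.\<close>
  obtain g where g: "g \<in> F" "((\<lambda>f. f + E f) ^^ n) f = f + of_nat n * E f + E (E g)"
    using E.one_plus_power_linear_term[OF f] by blast
  have "((\<lambda>f. f + E f) ^^ n) f = ((V ^^ n) ^^ p) f" by (simp add: E_def funpow_mult mult.commute)
  also have "\<dots> = f" by (induction p) (simp_all add: torsion f)
  finally have "of_nat n * E f + E (E g) = 0" using g(2) by (simp add: add.assoc)
  moreover have "E (E g) = 0" using V_pow_M[OF E_mem[OF g(1)]] by (simp add: E_def)
  ultimately have "of_nat n * E f = 0" by simp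
  then have "E f = 0" using \<open>n > 0\<close> by (auto simp: fun_eq_iff)
  then show ?thesis by (simp add: E_def)
qed

end

section \<open>Reduction to extensions of prime index\<close>

context group
begin

text \<open>Commutators of \<open>H\<close> lie in \<open>K\<close>, so \<open>H\<close> normalizes
  \<open>K\<close>. If \<open>x\<close> has order \<open>d\<close> modulo \<open>K\<close> and the
  prime \<open>p\<close> divides \<open>d\<close>, then \<open>t = x [^] (d / p)\<close> has order
  \<open>p\<close> modulo \<open>K\<close>, and \<open>K'\<close> is generated by \<open>K\<close>
  and \<open>t\<close>.\<close>

lemma exists_prime_index_extension:
  assumes fin: "finite (carrier G)" and K: "subgroup K G" and H: "subgroup H G" and "K \<subset> H"
    and der: "derived G H \<subseteq> K"
  shows "\<exists>K' t p. prime_index_extension G K K' t p \<and> K' \<subseteq> H \<and> card K' = p * card K"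
proof -
  interpret K: subgroup K G by fact
  interpret H: subgroup H G by fact
  have comm: "h1 \<otimes> h2 \<otimes> inv h1 \<otimes> inv h2 \<in> K" if "h1 \<in> H" "h2 \<in> H" for h1 h2
  proof -
    have "h1 \<otimes> h2 \<otimes> inv h1 \<otimes> inv h2 \<in> derived G H"
      unfolding derived_def using that by (auto intro: generate.incl)
    then show ?thesis using der by blast
  qed
  have conj: "h \<otimes> k \<otimes> inv h \<in> K" if h: "h \<in> H" and k: "k \<in> K" for h k
  proof -
    have kH: "k \<in> H" using k \<open>K \<subset> H\<close> by auto
    have "h \<otimes> k \<otimes> inv h = (h \<otimes> k \<otimes> inv h \<otimes> inv k) \<otimes> k"
      using h kH by (simp add: m_assoc)
    then show ?thesis using K.m_closed[OF comm[OF h kH] k] by simp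
  qed
  obtain x where x: "x \<in> H" "x \<notin> K" using \<open>K \<subset> H\<close> by blast
  have xc: "x \<in> carrier G" using x by simp
  define d where "d = (LEAST n. 0 < n \<and> x [^] (n::nat) \<in> K)"
  have "0 < order G \<and> x [^] order G \<in> K"
    using fin xc by (simp add: order_gt_0_iff_finite pow_order_eq_1)
  then have d: "0 < d" "x [^] d \<in> K" unfolding d_def by (metis (mono_tags, lifting) LeastI)+
  have d_min: "d \<le> n" if "0 < n" "x [^] n \<in> K" for n
    unfolding d_def using that by (intro Least_le) simp
  have "d \<noteq> 1" using d(2) x xc by auto
  then obtain p where p: "Factorial_Ring.prime p" "p dvd d" using prime_factor_nat by blast
  then obtain c where c: "d = p * c" by (elim dvdE)
  define t where "t = x [^] c"
  have p1: "p > 1" using p(1) by (rule prime_gt_1_nat)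
  have c0: "0 < c" "c < d" using d(1) c p1 by auto
  have t_notin: "t \<notin> K" using d_min[of c] c0 by (auto simp: t_def)
  have pow_H: "h [^] (n::nat) \<in> H" if "h \<in> H" for h n
    using that by (induction n) auto
  have t_H: "t \<in> H" unfolding t_def using x by (intro pow_H)
  have tc: "t \<in> carrier G" using t_H by simp
  have t_pow: "t [^] p \<in> K" using d(2) xc by (simp add: t_def nat_pow_pow c mult.commute)
  define K' where "K' = {k \<otimes> t [^] i | k i. k \<in> K \<and> i \<in> (UNIV :: nat set)}"
  have K'I: "k \<otimes> t [^] i \<in> K'" if "k \<in> K" for k and i :: nat
    using that by (auto simp: K'_def)
  have K'_H: "K' \<subseteq> H" using \<open>K \<subset> H\<close> t_H by (auto simp: K'_def pow_H)
  have K_K': "K \<subseteq> K'" using K'I[of _ 0] by auto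
  have t_K': "t \<in> K'" using K'I[OF K.one_closed, of 1] tc by simp
  have K'_mult: "y \<otimes> z \<in> K'" if y: "y \<in> K'" and z: "z \<in> K'" for y z
  proof -
    obtain k i where k: "k \<in> K" "y = k \<otimes> t [^] (i::nat)" using y by (auto simp: K'_def)
    obtain l j where l: "l \<in> K" "z = l \<otimes> t [^] (j::nat)" using z by (auto simp: K'_def)
    have "y \<otimes> z = (k \<otimes> (t [^] i \<otimes> l \<otimes> inv (t [^] i))) \<otimes> t [^] (i + j)"
      using k l tc by (simp add: m_assoc nat_pow_mult[symmetric]) (simp add: m_assoc[symmetric])
    then show ?thesis using K'I k l conj pow_H t_H by auto
  qed
  have subgroup_K': "subgroup K' G"
  proof (rule subgroupI)
    show "K' \<subseteq> carrier G" using K'_H H.subset by blast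
    show "K' \<noteq> {}" using t_K' by auto
    fix y assume y: "y \<in> K'"
    have yc: "y \<in> carrier G" using y K'_H by auto
    have pow: "y [^] (n::nat) \<in> K'" for n
      using y K_K' by (induction n) (auto intro: K'_mult)
    \<comment> \<open>In a finite group inverses are powers, so closure under products is
      enough.\<close>
    have "y [^] (order G - 1) \<otimes> y = y [^] order G"
      using fin nat_pow_Suc[of y "order G - 1"] by (simp add: order_gt_0_iff_finite)
    then have "y [^] (order G - 1) \<otimes> y = \<one>" using yc by (simp add: pow_order_eq_1)
    then have "inv y = y [^] (order G - 1)" using yc by (intro inv_equality) auto
    then show "inv y \<in> K'" using pow by simp
  qed (rule K'_mult)
  have norm: "inv t \<otimes> k \<otimes> t \<in> K" if "k \<in> K" for k
    using conj[of "inv t" k] t_H tc that by simp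
  have ext: "prime_index_extension G K K' t p"
    by unfold_locales (use K subgroup_K' K_K' t_K' t_notin p t_pow norm in \<open>auto simp: K'_def subgroup_def\<close>)
  have t_mem: "t [^] (j::nat) \<in> K \<longleftrightarrow> p dvd j" for j
    by (rule pow_mem_subgroup_iff[OF K tc t_notin p(1) t_pow])
  \<comment> \<open>Exponents below \<open>p\<close> give a normal form for \<open>K'\<close>, hence
    its cardinality.\<close>
  have "bij_betw (\<lambda>(k, i). k \<otimes> t [^] i) (K \<times> {..<p}) K'"
  proof (rule bij_betw_imageI)
    have le: "k = l \<and> i = j" if "k \<in> K" "l \<in> K" "i \<le> j" "j < p" "k \<otimes> t [^] i = l \<otimes> t [^] j" for k l and i j :: nat
    proof -
      have "t [^] j = t [^] (j - i) \<otimes> t [^] i" using that(3) tc by (simp add: nat_pow_mult)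
      then have "k \<otimes> t [^] i = (l \<otimes> t [^] (j - i)) \<otimes> t [^] i" using that tc by (simp add: m_assoc)
      then have eq: "k = l \<otimes> t [^] (j - i)" using that tc by simp
      then have "t [^] (j - i) = inv l \<otimes> k" using that tc by (simp add: m_assoc[symmetric])
      then have "t [^] (j - i) \<in> K" using that by simp
      then have "p dvd j - i" using t_mem by simp
      then have "i = j" using dvd_imp_le[of p "j - i"] that(3,4) by (cases "j - i = 0") auto
      then show ?thesis using eq that by simp
    qed
    show "inj_on (\<lambda>(k, i). k \<otimes> t [^] i) (K \<times> {..<p})"
    proof (rule inj_onI)
      fix a b assume mem: "a \<in> K \<times> {..<p}" "b \<in> K \<times> {..<p}"
        and eq: "(case a of (k, i) \<Rightarrow> k \<otimes> t [^] i) = (case b of (k, i) \<Rightarrow> k \<otimes> t [^] i)"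
      obtain k i l j where ab: "a = (k, i)" "b = (l, j)" by (metis surj_pair)
      have *: "k \<in> K" "l \<in> K" "i < p" "j < p" using mem by (simp_all add: ab)
      have "k \<otimes> t [^] i = l \<otimes> t [^] j" using eq by (simp only: ab prod.case)
      then have "k = l \<and> i = j"
        using le[OF *(1,2) _ *(4)] le[OF *(2,1) _ *(3)] by (metis nle_le)
      then show "a = b" by (simp add: ab)
    qed
    show "(\<lambda>(k, i). k \<otimes> t [^] i) ` (K \<times> {..<p}) = K'"
    proof
      show "(\<lambda>(k, i). k \<otimes> t [^] i) ` (K \<times> {..<p}) \<subseteq> K'" using K'I by auto
      show "K' \<subseteq> (\<lambda>(k, i). k \<otimes> t [^] i) ` (K \<times> {..<p})"
      proof
        fix y assume "y \<in> K'"
        then obtain k i where k: "k \<in> K" "y = k \<otimes> t [^] (i::nat)" by (auto simp: K'_def)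
        have "t [^] i = t [^] (p * (i div p)) \<otimes> t [^] (i mod p)" using tc by (simp add: nat_pow_mult)
        then have "y = (k \<otimes> t [^] (p * (i div p))) \<otimes> t [^] (i mod p)" using k tc by (simp add: m_assoc)
        moreover have "k \<otimes> t [^] (p * (i div p)) \<in> K" using k t_mem by simp
        moreover have "i mod p < p" using p1 by simp
        ultimately show "y \<in> (\<lambda>(k, i). k \<otimes> t [^] i) ` (K \<times> {..<p})" by (intro image_eqI[of _ _ "(k \<otimes> t [^] (p * (i div p)), i mod p)"]) auto
      qed
    qed
  qed
  then have "card K' = p * card K"
    using bij_betw_same_card by (fastforce simp: card_cartesian_product mult.commute)
  then show ?thesis using ext K'_H by blast
qed

section \<open>Group ring arithmetic and orders\<close>

lemma grp_ring_mult_elem: "grp_ring_elem G (grp_ring_mult G f g)"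
  by (simp add: grp_ring_elem_def grp_ring_mult_def)

lemma grp_ring_mult_assoc:
  "grp_ring_mult G (grp_ring_mult G f g) h = grp_ring_mult G f (grp_ring_mult G g h)"
proof
  fix x
  show "grp_ring_mult G (grp_ring_mult G f g) h x = grp_ring_mult G f (grp_ring_mult G g h) x"
  proof (cases "x \<in> carrier G")
    case x: True
    have inner: "(\<Sum>y\<in>carrier G. g (inv z \<otimes> y) * h (inv y \<otimes> x))
        = (\<Sum>w\<in>carrier G. g w * h (inv w \<otimes> (inv z \<otimes> x)))" if z: "z \<in> carrier G" for z
    proof -
      have cancel: "z \<otimes> (inv z \<otimes> a) = a" "inv z \<otimes> (z \<otimes> a) = a" if "a \<in> carrier G" for a
        using z that by (simp_all flip: m_assoc)
      show ?thesis
        by (rule sum.reindex_bij_witness[where i = "\<lambda>w. z \<otimes> w" and j = "\<lambda>y. inv z \<otimes> y"])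
          (use z x in \<open>auto simp: m_assoc inv_mult_group cancel\<close>)
    qed
    have "grp_ring_mult G (grp_ring_mult G f g) h x
        = (\<Sum>y\<in>carrier G. \<Sum>z\<in>carrier G. f z * (g (inv z \<otimes> y) * h (inv y \<otimes> x)))"
      using x by (simp add: grp_ring_mult_def sum_distrib_right mult.assoc)
    also have "\<dots> = (\<Sum>z\<in>carrier G. \<Sum>y\<in>carrier G. f z * (g (inv z \<otimes> y) * h (inv y \<otimes> x)))"
      by (rule sum.swap)
    also have "\<dots> = grp_ring_mult G f (grp_ring_mult G g h) x"
      using x inner by (simp add: grp_ring_mult_def sum_distrib_left[symmetric])
    finally show ?thesis .
  qed (simp add: grp_ring_mult_def)
qed

lemma grp_ring_mult_one_left:
  assumes "finite (carrier G)" "grp_ring_elem G f"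
  shows "grp_ring_mult G (grp_ring_one G) f = f"
  using assms by (auto simp: grp_ring_mult_def grp_ring_one_def grp_ring_elem_def fun_eq_iff if_distrib[of "\<lambda>a. a * _"] sum.delta cong: if_cong)

lemma grp_ring_mult_one_right:
  assumes fin: "finite (carrier G)" and f: "grp_ring_elem G f"
  shows "grp_ring_mult G f (grp_ring_one G) = f"
proof
  fix x
  show "grp_ring_mult G f (grp_ring_one G) x = f x"
  proof (cases "x \<in> carrier G")
    case x: True
    have "inv y \<otimes> x = \<one> \<longleftrightarrow> y = x" if "y \<in> carrier G" for y
      using that x by (metis inv_closed inv_equality inv_inv l_inv)
    then have "grp_ring_mult G f (grp_ring_one G) x = (\<Sum>y\<in>carrier G. if y = x then f y else 0)"
      using x by (auto simp: grp_ring_mult_def grp_ring_one_def intro!: sum.cong)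
    then show ?thesis using x fin by simp
  qed (use f in \<open>simp add: grp_ring_mult_def grp_ring_elem_def\<close>)
qed

lemma grp_ring_pow_elem: "grp_ring_elem G (grp_ring_pow G u n)"
  by (cases n) (auto simp: grp_ring_mult_elem grp_ring_elem_def grp_ring_one_def grp_ring_mult_def)

lemma grp_ring_pow_mult:
  assumes "finite (carrier G)" "grp_ring_elem G f"
  shows "grp_ring_mult G (grp_ring_pow G u n) f = (grp_ring_mult G u ^^ n) f"
  using assms(2)
proof (induction n arbitrary: f)
  case (Suc n)
  then show ?case by (simp add: grp_ring_mult_assoc grp_ring_mult_elem funpow_swap1)
qed (simp add: grp_ring_mult_one_left assms(1))

text \<open>The left regular representation is faithful: evaluation at the identity recovers the
  power of \<open>u\<close>.\<close>

lemma grp_ring_pow_eq_one_iff: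
  assumes "finite (carrier G)"
  shows "grp_ring_pow G u n = grp_ring_one G \<longleftrightarrow>
    (\<forall>f. grp_ring_elem G f \<longrightarrow> (grp_ring_mult G u ^^ n) f = f)"
proof
  assume "grp_ring_pow G u n = grp_ring_one G"
  then show "\<forall>f. grp_ring_elem G f \<longrightarrow> (grp_ring_mult G u ^^ n) f = f"
    using assms grp_ring_pow_mult[OF assms, of _ u n] grp_ring_mult_one_left by auto
next
  assume *: "\<forall>f. grp_ring_elem G f \<longrightarrow> (grp_ring_mult G u ^^ n) f = f"
  have "grp_ring_elem G (grp_ring_one G)" using grp_ring_pow_elem[of u 0] by simp
  then show "grp_ring_pow G u n = grp_ring_one G"
    using grp_ring_pow_mult[OF assms, of "grp_ring_one G" u n] * grp_ring_mult_one_right[OF assms grp_ring_pow_elem]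
    by simp
qed

lemma grp_ring_ord_dvd:
  assumes fin: "finite (carrier G)" and "grp_ring_torsion G u" and n: "grp_ring_pow G u n = grp_ring_one G"
  shows "grp_ring_ord G u dvd n"
proof -
  let ?U = "grp_ring_mult G u"
  define d where "d = grp_ring_ord G u"
  have d: "d > 0" "grp_ring_pow G u d = grp_ring_one G"
    using LeastI_ex[of "\<lambda>n. n > 0 \<and> grp_ring_pow G u n = grp_ring_one G"] assms(2)
    by (auto simp: d_def grp_ring_ord_def grp_ring_torsion_def)
  have "(?U ^^ (n mod d)) f = f" if f: "grp_ring_elem G f" for f
  proof -
    have Ud: "(?U ^^ d) f = f" using d(2) f by (simp add: grp_ring_pow_eq_one_iff[OF fin])
    have "((?U ^^ d) ^^ i) f = f" for i by (induction i) (simp_all add: Ud)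
    then have "(?U ^^ n) f = (?U ^^ (n mod d)) f"
      by (metis comp_apply funpow_add funpow_mult mod_mult_div_eq)
    then show ?thesis using n f by (simp add: grp_ring_pow_eq_one_iff[OF fin])
  qed
  then have "grp_ring_pow G u (n mod d) = grp_ring_one G" by (simp add: grp_ring_pow_eq_one_iff[OF fin])
  then have "n mod d = 0"
    using not_less_Least[of "n mod d" "\<lambda>n. n > 0 \<and> grp_ring_pow G u n = grp_ring_one G"] d(1)
    by (auto simp: d_def grp_ring_ord_def)
  then show ?thesis by (simp add: d_def dvd_eq_mod_eq_0)
qed

section \<open>Descent along a solvable chain\<close>

definition pow_trivial_on :: "('a \<Rightarrow> int) \<Rightarrow> 'a set \<Rightarrow> nat \<Rightarrow> bool" where
  "pow_trivial_on u H j \<longleftrightarrow> (\<forall>f\<in>right_invariant G H. (grp_ring_mult G u ^^ j) f = f)"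

text \<open>The operator is the \<open>j\<close>-th iterate of left multiplication by
  \<open>u\<close>; it commutes with right translations and is torsion because \<open>u\<close>
  is.\<close>

lemma pow_trivial_on_prime_extension:
  assumes ext: "prime_index_extension G K K' t p" and fin: "finite (carrier G)"
    and tors: "grp_ring_torsion G u" and triv: "pow_trivial_on u K' j"
  shows "pow_trivial_on u K (j * p)"
  unfolding pow_trivial_on_def
proof
  interpret prime_index_extension G K K' t p by fact
  let ?U = "grp_ring_mult G u"
  fix f assume f: "f \<in> right_invariant G K"
  obtain n where n: "n > 0" "grp_ring_pow G u n = grp_ring_one G"
    using tors by (auto simp: grp_ring_torsion_def)
  have U_mem: "(?U ^^ i) g \<in> right_invariant G K" if "g \<in> right_invariant G K" for g i
    using that by (induction i) (simp_all add: grp_ring_mult_right_invariant K_carrier)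
  have "((?U ^^ j) ^^ p) f = f"
  proof (rule torsion_power_p_trivial_on_right_invariant)
    show "additive (?U ^^ j)" by (intro additive_funpow additive_grp_ring_mult)
    show "(?U ^^ j) (right_shift G t g) = right_shift G t ((?U ^^ j) g)" for g
      by (induction j) (simp_all add: grp_ring_mult_right_shift t_carrier)
    show "((?U ^^ j) ^^ n) g = g" if "g \<in> right_invariant G K" for g
    proof -
      have "(?U ^^ n) g = g" using n(2) that by (simp add: grp_ring_pow_eq_one_iff[OF fin] right_invariant_def)
      then have "((?U ^^ n) ^^ j) g = g" by (induction j) simp_all
      then show ?thesis by (simp add: funpow_mult mult.commute)
    qed
  qed (use n f U_mem triv in \<open>auto simp: pow_trivial_on_def\<close>)
  then show "(?U ^^ (j * p)) f = f" by (simp add: funpow_mult mult.commute)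
qed

text \<open>Insert \<open>K'\<close> just above \<open>K\<close>. The induction hypothesis descends
  from \<open>H\<close> to \<open>K'\<close>, and a step of prime index from \<open>K'\<close> to
  \<open>K\<close>, multiplying the exponent by \<open>p\<close>.\<close>

lemma pow_trivial_on_abelian_extension:
  assumes fin: "finite (carrier G)" and K: "subgroup K G" and H: "subgroup H G" and "K \<subseteq> H"
    and "derived G H \<subseteq> K" and tors: "grp_ring_torsion G u"
  shows "\<exists>m. card H = m * card K \<and> (\<forall>j. pow_trivial_on u H j \<longrightarrow> pow_trivial_on u K (j * m))"
  using assms(2,4,5)
proof (induction "card H - card K" arbitrary: K rule: less_induct)
  case less
  have finH: "finite H" using H fin by (meson rev_finite_subset subgroup.subset)
  show ?case
  proof (cases "K = H")
    case True
    then show ?thesis by (intro exI[of _ 1]) simp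
  next
    case False
    then have "K \<subset> H" using less.prems by blast
    then obtain K' t p where ext: "prime_index_extension G K K' t p" and K': "K' \<subseteq> H" "card K' = p * card K"
      using exists_prime_index_extension[OF fin less.prems(1) H] less.prems by blast
    interpret prime_index_extension G K K' t p by fact
    have "K \<subset> K'" using K_le t_mem t_notin by blast
    then have "card K < card K'" using K'(1) finH by (meson psubset_card_mono rev_finite_subset)
    moreover have "card K' \<le> card H" using K'(1) finH by (simp add: card_mono)
    ultimately have "card H - card K' < card H - card K" by simp
    then obtain m where m: "card H = m * card K'" "\<And>j. pow_trivial_on u H j \<Longrightarrow> pow_trivial_on u K' (j * m)"
      using less.hyps[OF _ subgroup_K' K'(1)] less.prems K_le by blast
    show ?thesis
      using m K' pow_trivial_on_prime_extension[OF ext fin tors]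
      by (intro exI[of _ "m * p"]) (auto simp: mult.assoc[symmetric])
  qed
qed

text \<open>Solvability is stated inside \<open>N\<close>, but the lattices consist of functions on
  \<open>G\<close>, so the chain is moved to \<open>G\<close>.\<close>

lemma solvable_seq_of_subgroup:
  assumes "solvable_seq (G\<lparr>carrier := N\<rparr>) H" "subgroup N G"
  shows "solvable_seq G H"
  using assms(1)
proof induction
  case unity
  then show ?case using solvable_seq.unity[of G] by simp
next
  case (extension K H)
  then show ?case
    using solvable_seq.extension[of G K H] incl_subgroup[OF assms(2)] by simp
qed

text \<open>Each step multiplies the exponent by its index, so the indices accumulate to
  \<open>card H\<close>; hence \<open>j\<close> is kept arbitrary.\<close>

lemma pow_trivial_on_solvable:
  assumes "solvable_seq G H" and fin: "finite (carrier G)" and tors: "grp_ring_torsion G u"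
    and "pow_trivial_on u H j"
  shows "pow_trivial_on u {\<one>} (j * card H)"
  using assms(1,4)
proof (induction arbitrary: j)
  case (extension K H)
  have K: "subgroup K G" using extension.hyps(1) by (rule solvable_imp_subgroup)
  have "K \<subseteq> H" using normal_imp_subgroup[OF extension.hyps(2)] subgroup.subset by fastforce
  then obtain m where "card H = m * card K" "pow_trivial_on u K (j * m)"
    using pow_trivial_on_abelian_extension[OF fin K extension.hyps(3) _ _ tors]
      derived_of_subgroup_minimal[OF extension.hyps(2,3,4)] extension.prems by blast
  then show ?case using extension.IH[of "j * m"] by (simp add: mult.assoc)
qed simp

text \<open>The factor \<open>f (inv y \<otimes> x)\<close> is constant on each coset of
  \<open>N\<close>, so only the coset sums of \<open>u\<close> matter, and these are 1 for
  \<open>N\<close> and 0 otherwise.\<close>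

lemma rel_normalized_unit_trivial_on_right_invariant:
  assumes fin: "finite (carrier G)" and N: "N \<lhd> G" and u: "omega G N u = grp_ring_one (G Mod N)"
    and f: "f \<in> right_invariant G N"
  shows "grp_ring_mult G u f = f"
proof
  fix x
  interpret N: normal N G by fact
  show "grp_ring_mult G u f x = f x"
  proof (cases "x \<in> carrier G")
    case x: True
    define c where "c C = f (inv (SOME y. y \<in> C) \<otimes> x)" for C
    have inv: "f (inv (n \<otimes> y) \<otimes> x) = f (inv y \<otimes> x)" if n: "n \<in> N" and y: "y \<in> carrier G" for n y
    proof -
      define z where "z = inv y \<otimes> x"
      have z: "z \<in> carrier G" using x y by (simp add: z_def)
      \<comment> \<open>Normality of \<open>N\<close> in \<open>G\<close> carries
        \<open>inv n\<close> to the right of \<open>x\<close>, where \<open>f\<close> absorbs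
        it.\<close>
      have "inv (n \<otimes> y) \<otimes> x = z \<otimes> (inv x \<otimes> inv n \<otimes> x)"
        using n y x by (simp add: z_def inv_mult_group m_assoc) (simp add: m_assoc[symmetric])
      moreover have "inv x \<otimes> inv n \<otimes> x \<in> N" using n x N.inv_op_closed1 by simp
      ultimately show ?thesis using f z by (simp add: right_invariant_def flip: z_def)
    qed
    have c: "f (inv y \<otimes> x) = c C" if C: "C \<in> rcosets N" and y: "y \<in> C" for C y
    proof -
      have "(SOME y. y \<in> C) \<in> C" using y by (rule someI)
      moreover obtain a where "a \<in> carrier G" "C = N #> a" using C by (auto simp: RCOSETS_def)
      ultimately show ?thesis using y inv by (auto simp: c_def r_coset_def)
    qed
    have disj: "pairwise disjnt (rcosets N)" using rcos_disjoint[OF N.subgroup_axioms] .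
    have finC: "finite C" if "C \<in> rcosets N" for C
      using rcosets_part_G[OF N.subgroup_axioms] fin that by (metis Union_upper finite_subset)
    have N_mem: "N \<in> rcosets N" using N.subgroup_in_rcosets[OF is_group] .
    have finR: "finite (rcosets N)"
      using rcosets_part_G[OF N.subgroup_axioms] fin by (metis finite_UnionD)
    have "grp_ring_mult G u f x = (\<Sum>y\<in>\<Union>(rcosets N). u y * f (inv y \<otimes> x))"
      using x rcosets_part_G[OF N.subgroup_axioms] by (simp add: grp_ring_mult_def)
    also have "\<dots> = (\<Sum>C\<in>rcosets N. \<Sum>y\<in>C. u y * f (inv y \<otimes> x))"
      using disj finC by (subst sum.Union_disjoint) (auto simp: pairwise_def disjnt_def)
    also have "\<dots> = (\<Sum>C\<in>rcosets N. (\<Sum>y\<in>C. u y) * c C)"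
      by (intro sum.cong) (auto simp: c sum_distrib_right)
    also have "\<dots> = (\<Sum>C\<in>rcosets N. if C = N then c C else 0)"
    proof (intro sum.cong refl)
      fix C assume C: "C \<in> rcosets N"
      have "(\<Sum>y\<in>C. u y) = omega G N u C" using C by (simp add: omega_def FactGroup_def)
      also have "\<dots> = (if C = N then 1 else 0)" unfolding u by (simp add: grp_ring_one_def FactGroup_def)
      finally show "(\<Sum>y\<in>C. u y) * c C = (if C = N then c C else 0)" by simp
    qed
    also have "\<dots> = c N" using N_mem finR by simp
    also have "\<dots> = f x" using c[OF N_mem N.one_closed] x by simp
    finally show ?thesis .
  qed (use f in \<open>simp add: grp_ring_mult_def right_invariant_def grp_ring_elem_def\<close>)
qed

end

theorem mainTheorem3:
  fixes G (structure) and N :: "'a set" and u :: "'a \<Rightarrow> int"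
  assumes "group G" and "finite (carrier G)"
    and "N \<lhd> G" and "solvable (G\<lparr>carrier := N\<rparr>)"
    and "u \<in> rel_normalized_units G N" and "grp_ring_torsion G u"
  shows "grp_ring_ord G u dvd card N"
proof -
  interpret group G by fact
  have "solvable_seq G N"
    using assms(4) solvable_seq_of_subgroup[of N N] normal_imp_subgroup[OF assms(3)] by (simp add: solvable_def)
  moreover have "pow_trivial_on u N 1"
    using rel_normalized_unit_trivial_on_right_invariant[OF assms(2,3), of u] assms(5)
    by (simp add: pow_trivial_on_def rel_normalized_units_def)
  ultimately have "pow_trivial_on u {\<one>} (card N)"
    using pow_trivial_on_solvable[of N u 1] assms(2,6) by simp
  \<comment> \<open>At the bottom of the chain the lattice is the whole group ring, on which
    \<open>u\<close> acts faithfully.\<close>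
  moreover have "right_invariant G {\<one>} = {f. grp_ring_elem G f}"
    by (auto simp: right_invariant_def)
  ultimately have "grp_ring_pow G u (card N) = grp_ring_one G"
    by (simp add: pow_trivial_on_def grp_ring_pow_eq_one_iff[OF assms(2)])
  then show ?thesis by (rule grp_ring_ord_dvd[OF assms(2,6)])
qed

end
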